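(* Let $i\in\{1,2\}$, $\varepsilon=(-1)^i$, and let $\mathcal{S}_i$ be the timelike general rotational surface of first type ($i=1$) or second type ($i=2$) determined by $f,g,\alpha,\beta$. Let $\lambda_1,\lambda_2,\lambda_3,\lambda_4\in\mathbb{R}$ be not all zero, put $\delta=\lambda_1+\lambda_2+\lambda_3-\lambda_4$, and equip $\mathbb{E}_1^4$ with the density $e^{\lambda_1x^2+\lambda_2y^2+\lambda_3z^2+\lambda_4t^2}$. Then the weighted Gaussian curvature of $\mathcal{S}_i$ is $$K_\phi^{\mathcal{S}_i}=\frac{\begin{aligned}&-2\delta\left((\alpha f)^2+\varepsilon(\beta g)^2\right)^2\left(-\varepsilon f'^2+g'^2\right)^2+\alpha^2\beta^2\left(gf'-fg'\right)^2\left(-\varepsilon f'^2+g'^2\right)\\&+\left(\varepsilon(\alpha f)^2+(\beta g)^2\right)\left(\beta^2gf'+\alpha^2fg'\right)\left(f''g'-f'g''\right)\end{aligned}}{\left((\alpha f)^2+\varepsilon(\beta g)^2\right)^2\left(-\varepsilon f'^2+g'^2\right)^2}.$$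
   Context: $\mathbb{E}_1^4$ is $\mathbb{R}^4$ with coordinates $(x,y,z,t)$ and the metric $dx^2+dy^2+dz^2-dt^2$. Let $\alpha,\beta>0$ be constants, $J\subset\mathbb{R}$ an open interval, $f,g:J\to\mathbb{R}$ smooth functions of $u$ (primes denote $d/du$), and $v\in[0,2\pi)$. First type: $\mathcal{S}_1: X_1(u,v)=(f\cos(\alpha v),f\sin(\alpha v),g\cosh(\beta v),g\sinh(\beta v))$ with $\alpha^2f^2-\beta^2g^2<0$ and $f'^2+g'^2>0$ on $J$. Second type: $\mathcal{S}_2: X_2(u,v)=(f\cos(\alpha v),f\sin(\alpha v),g\sinh(\beta v),g\cosh(\beta v))$ with $f'^2-g'^2<0$ and $\alpha^2f^2+\beta^2g^2>0$ on $J$. Both surfaces are timelike. With $\varepsilon=(-1)^i$, the Gaussian curvature of $\mathcal{S}_i$ is $$K^{\mathcal{S}_i}=\frac{\alpha^2\beta^2(gf'-fg')^2(-\varepsilon f'^2+g'^2)+\left(\varepsilon(\alpha f)^2+(\beta g)^2\right)(\alpha^2fg'+\beta^2gf')(f''g'-f'g'')}{\left((\alpha f)^2+\varepsilon(\beta g)^2\right)^2(-\varepsilon f'^2+g'^2)^2}.$$ For a density $e^\phi$ on $\mathbb{E}_1^4$, the weighted Gaussian curvature is $K_\phi^{\mathcal{S}_i}=K^{\mathcal{S}_i}-\Delta\phi$, where $\Delta$ is the Laplacian of $\mathbb{E}_1^4$, $\Delta\phi=\phi_{xx}+\phi_{yy}+\phi_{zz}-\phi_{tt}$. *)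

theory Defs
  imports "HOL-Analysis.Analysis"
begin

text \<open>The coordinates \<open>(x, y, z, t)\<close> of Minkowski 4-space are the components 1, 2, 3, 4 of
  \<^typ>\<open>real ^ 4\<close>.\<close>

definition minkowski :: "real ^ 4 \<Rightarrow> real ^ 4 \<Rightarrow> real" where
  "minkowski p q = p $ 1 * q $ 1 + p $ 2 * q $ 2 + p $ 3 * q $ 3 - p $ 4 * q $ 4"

definition partial :: "4 \<Rightarrow> (real ^ 4 \<Rightarrow> real) \<Rightarrow> real ^ 4 \<Rightarrow> real" where
  "partial k \<phi> p = deriv (\<lambda>h. \<phi> (p + h *\<^sub>R axis k 1)) 0"

definition minkowski_laplacian :: "(real ^ 4 \<Rightarrow> real) \<Rightarrow> real ^ 4 \<Rightarrow> real" where
  "minkowski_laplacian \<phi> p =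
     partial 1 (partial 1 \<phi>) p + partial 2 (partial 2 \<phi>) p
     + partial 3 (partial 3 \<phi>) p - partial 4 (partial 4 \<phi>) p"

definition partial_u :: "(real \<Rightarrow> real \<Rightarrow> real ^ 4) \<Rightarrow> real \<Rightarrow> real \<Rightarrow> real ^ 4" where
  "partial_u X u v = vector_derivative (\<lambda>s. X s v) (at u)"

definition partial_v :: "(real \<Rightarrow> real \<Rightarrow> real ^ 4) \<Rightarrow> real \<Rightarrow> real \<Rightarrow> real ^ 4" where
  "partial_v X u v = vector_derivative (\<lambda>s. X u s) (at v)"

text \<open>The component of \<open>w\<close> that is Minkowski-orthogonal to \<open>span {a, b}\<close>. It exists and is
  unique whenever the plane \<open>span {a, b}\<close> is nondegenerate.\<close>

definition normal_component :: "real ^ 4 \<Rightarrow> real ^ 4 \<Rightarrow> real ^ 4 \<Rightarrow> real ^ 4" where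
  "normal_component a b w =
     (THE n. minkowski n a = 0 \<and> minkowski n b = 0 \<and> w - n \<in> span {a, b})"

text \<open>The Gaussian curvature of a parametrized surface with nondegenerate induced metric,
  \<open>(\<langle>II(X\<^sub>u,X\<^sub>u), II(X\<^sub>v,X\<^sub>v)\<rangle> - \<langle>II(X\<^sub>u,X\<^sub>v), II(X\<^sub>u,X\<^sub>v)\<rangle>) / (EG - F\<^sup>2)\<close>.
  The ambient space is flat, so the vector-valued second fundamental form \<open>II\<close> consists of the
  normal components of the second-order partial derivatives of \<open>X\<close>.\<close>

definition gauss_curvature :: "(real \<Rightarrow> real \<Rightarrow> real ^ 4) \<Rightarrow> real \<Rightarrow> real \<Rightarrow> real" where
  "gauss_curvature X u v =
     (let Xu = partial_u X u v;
          Xv = partial_v X u v;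
          IIuu = normal_component Xu Xv (partial_u (partial_u X) u v);
          IIuv = normal_component Xu Xv (partial_v (partial_u X) u v);
          IIvv = normal_component Xu Xv (partial_v (partial_v X) u v)
      in (minkowski IIuu IIvv - minkowski IIuv IIuv)
         / (minkowski Xu Xu * minkowski Xv Xv - (minkowski Xu Xv)\<^sup>2))"

text \<open>For the density \<open>e\<^sup>\<phi>\<close>; the argument is the exponent \<open>\<phi>\<close>.\<close>

definition weighted_gauss_curvature ::
    "(real ^ 4 \<Rightarrow> real) \<Rightarrow> (real \<Rightarrow> real \<Rightarrow> real ^ 4) \<Rightarrow> real \<Rightarrow> real \<Rightarrow> real" where
  "weighted_gauss_curvature \<phi> X u v = gauss_curvature X u v - minkowski_laplacian \<phi> (X u v)"

definition smooth_on_open :: "real set \<Rightarrow> (real \<Rightarrow> real) \<Rightarrow> bool" where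
  "smooth_on_open J f \<longleftrightarrow> (\<forall>n. \<forall>u\<in>J. (deriv ^^ n) f field_differentiable (at u))"

definition rotational_surface ::
    "nat \<Rightarrow> real \<Rightarrow> real \<Rightarrow> (real \<Rightarrow> real) \<Rightarrow> (real \<Rightarrow> real) \<Rightarrow> real \<Rightarrow> real \<Rightarrow> real ^ 4" where
  "rotational_surface i \<alpha> \<beta> f g u v =
     (if i = 1
      then vector [f u * cos (\<alpha> * v), f u * sin (\<alpha> * v), g u * cosh (\<beta> * v), g u * sinh (\<beta> * v)]
      else vector [f u * cos (\<alpha> * v), f u * sin (\<alpha> * v), g u * sinh (\<beta> * v), g u * cosh (\<beta> * v)])"

text \<open>The inequalities say that the induced metric, with \<open>F = 0\<close>, satisfies \<open>G < 0 < E\<close> for the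
  first type and \<open>E < 0 < G\<close> for the second; either way the surface is timelike.\<close>

definition timelike_rotational_data ::
    "nat \<Rightarrow> real set \<Rightarrow> real \<Rightarrow> real \<Rightarrow> (real \<Rightarrow> real) \<Rightarrow> (real \<Rightarrow> real) \<Rightarrow> bool" where
  "timelike_rotational_data i J \<alpha> \<beta> f g \<longleftrightarrow>
     open J \<and> is_interval J \<and> \<alpha> > 0 \<and> \<beta> > 0 \<and> smooth_on_open J f \<and> smooth_on_open J g \<and>
     (\<forall>u\<in>J. if i = 1
        then \<alpha>\<^sup>2 * (f u)\<^sup>2 - \<beta>\<^sup>2 * (g u)\<^sup>2 < 0 \<and> (deriv f u)\<^sup>2 + (deriv g u)\<^sup>2 > 0
        else (deriv f u)\<^sup>2 - (deriv g u)\<^sup>2 < 0 \<and> \<alpha>\<^sup>2 * (f u)\<^sup>2 + \<beta>\<^sup>2 * (g u)\<^sup>2 > 0)"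

end

theory Submission
  imports Defs
begin

text \<open>
  The weighted curvature differs from the Gaussian curvature by the Minkowski Laplacian of \<open>\<phi>\<close>,
  and for a diagonal quadratic form this Laplacian is the constant \<open>2\<delta>\<close> (lemma
  \<open>minkowski_laplacian_diagonal_quadratic\<close>).  Over the common denominator it contributes the first
  summand of the numerator, so everything else is the Gaussian curvature of the surface itself.

  The parametrization is orthogonal.  Projecting off an orthogonal basis \<open>X\<^sub>u, X\<^sub>v\<close> of the tangent
  plane with nonzero squares \<open>E, G\<close> turns inner products of normal components into
  \<open>\<langle>w, w'\<rangle> - \<langle>w, X\<^sub>u\<rangle>\<langle>w', X\<^sub>u\<rangle> / E - \<langle>w, X\<^sub>v\<rangle>\<langle>w', X\<^sub>v\<rangle> / G\<close>, so the curvature is a rational function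
  of inner products of derivatives of \<open>X\<close> (lemma \<open>gauss_curvature_orthogonal\<close>).

  The two types of surface are treated at once.  Both have the form
  \<open>(f cos \<alpha>v, f sin \<alpha>v, g h(\<beta>v), g k(\<beta>v))\<close> where \<open>h' = k\<close>, \<open>k' = h\<close> and \<open>h\<^sup>2 - k\<^sup>2 = -\<epsilon>\<close>: the pair
  \<open>(h, k)\<close> is \<open>(cosh, sinh)\<close> for the first type and \<open>(sinh, cosh)\<close> for the second.  These three
  properties together with \<open>cos\<^sup>2 + sin\<^sup>2 = 1\<close> remove \<open>v\<close> from all inner products, and what remains
  is an identity of rational functions in which \<open>\<epsilon>\<^sup>2 = 1\<close>.
\<close>

section \<open>The Laplacian of a diagonal quadratic form\<close>

text \<open>Stated for polynomials with \<open>a\<close> arbitrary, so that one lemma serves both differentiations: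
  a quadratic form along a coordinate line and, with \<open>a = 0\<close>, its first partial derivatives.\<close>

lemma partial_quadratic:
  assumes "\<And>h. \<phi> (p + h *\<^sub>R axis k 1) = a * h\<^sup>2 + b * h + c"
  shows "partial k \<phi> p = b"
  unfolding partial_def assms
  by (rule DERIV_imp_deriv) (auto intro!: derivative_eq_intros)

text \<open>The pure second partial derivatives are \<open>2 * l1, ..., 2 * l4\<close>, and the last one enters the
  Minkowski Laplacian with a minus sign.\<close>

lemma minkowski_laplacian_diagonal_quadratic:
  fixes l1 l2 l3 l4 :: real
  defines "\<phi> \<equiv> \<lambda>p. l1 * (p $ 1)\<^sup>2 + l2 * (p $ 2)\<^sup>2 + l3 * (p $ 3)\<^sup>2 + l4 * (p $ 4)\<^sup>2"
  shows "minkowski_laplacian \<phi> p = 2 * (l1 + l2 + l3 - l4)"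
proof -
  have partials: "partial 1 \<phi> = (\<lambda>p. 2 * l1 * p $ 1)" "partial 2 \<phi> = (\<lambda>p. 2 * l2 * p $ 2)"
    "partial 3 \<phi> = (\<lambda>p. 2 * l3 * p $ 3)" "partial 4 \<phi> = (\<lambda>p. 2 * l4 * p $ 4)"
  proof -
    show "partial 1 \<phi> = (\<lambda>p. 2 * l1 * p $ 1)"
      by (intro ext partial_quadratic[where a = l1 and c = "\<phi> _"])
         (simp add: \<phi>_def axis_def algebra_simps power2_eq_square)
    show "partial 2 \<phi> = (\<lambda>p. 2 * l2 * p $ 2)"
      by (intro ext partial_quadratic[where a = l2 and c = "\<phi> _"])
         (simp add: \<phi>_def axis_def algebra_simps power2_eq_square)
    show "partial 3 \<phi> = (\<lambda>p. 2 * l3 * p $ 3)"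
      by (intro ext partial_quadratic[where a = l3 and c = "\<phi> _"])
         (simp add: \<phi>_def axis_def algebra_simps power2_eq_square)
    show "partial 4 \<phi> = (\<lambda>p. 2 * l4 * p $ 4)"
      by (intro ext partial_quadratic[where a = l4 and c = "\<phi> _"])
         (simp add: \<phi>_def axis_def algebra_simps power2_eq_square)
  qed
  have second: "partial k (\<lambda>p. c * p $ k) p = c" for k c
    by (rule partial_quadratic[where a = 0 and c = "c * p $ k"])
       (simp add: axis_def algebra_simps)
  show ?thesis
    unfolding minkowski_laplacian_def partials second by simp
qed

section \<open>Gaussian curvature of an orthogonal parametrization\<close>

lemma minkowski_bilinear:
  "minkowski (p + p') q = minkowski p q + minkowski p' q"
  "minkowski (p - p') q = minkowski p q - minkowski p' q"
  "minkowski (c *\<^sub>R p) q = c * minkowski p q"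
  "minkowski p (q + q') = minkowski p q + minkowski p q'"
  "minkowski p (q - q') = minkowski p q - minkowski p q'"
  "minkowski p (c *\<^sub>R q) = c * minkowski p q"
  by (simp_all add: minkowski_def algebra_simps)

lemma minkowski_commute: "minkowski p q = minkowski q p"
  by (simp add: minkowski_def mult.commute)

text \<open>Gram--Schmidt works in an indefinite metric as long as no square in the basis vanishes.  The
  same condition gives uniqueness: the difference of two candidates lies in the plane and is
  orthogonal to \<open>a\<close> and \<open>b\<close>, which makes both of its coefficients zero.\<close>

lemma normal_component_orthogonal:
  assumes ab: "minkowski a b = 0" and a: "minkowski a a \<noteq> 0" and b: "minkowski b b \<noteq> 0"
  shows "normal_component a b w =
    w - (minkowski w a / minkowski a a) *\<^sub>R a - (minkowski w b / minkowski b b) *\<^sub>R b"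
    (is "_ = ?n")
  unfolding normal_component_def
proof (rule the_equality)
  have ba: "minkowski b a = 0"
    using ab by (simp add: minkowski_commute)
  have "w - ?n = (minkowski w a / minkowski a a) *\<^sub>R a + (minkowski w b / minkowski b b) *\<^sub>R b"
    by simp
  also have "\<dots> \<in> span {a, b}"
    by (intro span_add span_scale span_base) auto
  finally show n: "minkowski ?n a = 0 \<and> minkowski ?n b = 0 \<and> w - ?n \<in> span {a, b}"
    using ab ba a b by (simp add: minkowski_bilinear)
  fix m assume m: "minkowski m a = 0 \<and> minkowski m b = 0 \<and> w - m \<in> span {a, b}"
  have "(w - m) - (w - ?n) \<in> span {a, b}"
    using m n span_diff by blast
  then have "?n - m \<in> span {a, b}"
    by (simp add: algebra_simps)
  then obtain r s where rs: "?n - m = r *\<^sub>R a + s *\<^sub>R b"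
    by (auto simp: span_insert span_singleton algebra_simps)
  have "minkowski (?n - m) a = 0" "minkowski (?n - m) b = 0"
    using m n by (simp_all only: minkowski_bilinear)
  then have "r = 0" "s = 0"
    using ab ba a b unfolding rs by (simp_all add: minkowski_bilinear)
  then show "m = ?n"
    using rs by simp
qed

lemma minkowski_normal_components:
  assumes ab: "minkowski a b = 0" and a: "minkowski a a \<noteq> 0" and b: "minkowski b b \<noteq> 0"
  shows "minkowski (normal_component a b w) (normal_component a b z) =
    minkowski w z - minkowski w a * minkowski z a / minkowski a a
      - minkowski w b * minkowski z b / minkowski b b"
proof -
  have ba: "minkowski b a = 0"
    using ab by (simp add: minkowski_commute)
  show ?thesis
    unfolding normal_component_orthogonal[OF assms]
    using ab ba a b
    by (simp add: minkowski_bilinear minkowski_commute[of a z] minkowski_commute[of b z])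
qed

lemma gauss_curvature_orthogonal:
  fixes X u v
  defines "Xu \<equiv> partial_u X u v" and "Xv \<equiv> partial_v X u v"
    and "Xuu \<equiv> partial_u (partial_u X) u v" and "Xuv \<equiv> partial_v (partial_u X) u v"
    and "Xvv \<equiv> partial_v (partial_v X) u v"
  defines "E \<equiv> minkowski Xu Xu" and "G \<equiv> minkowski Xv Xv"
  assumes F: "minkowski Xu Xv = 0" and E: "E \<noteq> 0" and G: "G \<noteq> 0"
  shows "gauss_curvature X u v =
    (minkowski Xuu Xvv - minkowski Xuu Xu * minkowski Xvv Xu / E
        - minkowski Xuu Xv * minkowski Xvv Xv / G
      - (minkowski Xuv Xuv - (minkowski Xuv Xu)\<^sup>2 / E - (minkowski Xuv Xv)\<^sup>2 / G)) / (E * G)"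
proof -
  note normal = minkowski_normal_components[OF F E[unfolded E_def] G[unfolded G_def]]
  show ?thesis
    unfolding gauss_curvature_def Let_def
    unfolding Xu_def[symmetric] Xv_def[symmetric] Xuu_def[symmetric] Xuv_def[symmetric]
      Xvv_def[symmetric] normal F E_def[symmetric] G_def[symmetric]
    by (simp add: power2_eq_square)
qed

section \<open>General rotational surfaces\<close>

lemma vector_4_nth [simp]:
  "(vector [a, b, c, d] :: 'a::zero ^ 4) $ 1 = a" "(vector [a, b, c, d] :: 'a ^ 4) $ 2 = b"
  "(vector [a, b, c, d] :: 'a ^ 4) $ 3 = c" "(vector [a, b, c, d] :: 'a ^ 4) $ 4 = d"
  unfolding vector_def by simp_all

lemma vector_derivative_vector_4:
  fixes a b c d :: "real \<Rightarrow> real"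
  assumes "(a has_real_derivative a') (at x)" "(b has_real_derivative b') (at x)"
    "(c has_real_derivative c') (at x)" "(d has_real_derivative d') (at x)"
  shows "vector_derivative (\<lambda>s. vector [a s, b s, c s, d s] :: real ^ 4) (at x) =
    vector [a', b', c', d']"
proof (rule vector_derivative_at)
  have split: "(vector [p, q, r, s] :: real ^ 4) =
    p *\<^sub>R axis 1 1 + q *\<^sub>R axis 2 1 + r *\<^sub>R axis 3 1 + s *\<^sub>R axis 4 1" for p q r s
    by (simp add: vec_eq_iff forall_4 axis_def)
  show "((\<lambda>s. vector [a s, b s, c s, d s] :: real ^ 4) has_vector_derivative
      vector [a', b', c', d']) (at x)"
    unfolding split using assms by (auto intro!: derivative_eq_intros)
qed

lemma vector_derivative_eq_on_open:
  fixes X Y :: "real \<Rightarrow> 'a::real_normed_vector"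
  assumes "open J" "x \<in> J" "\<And>s. s \<in> J \<Longrightarrow> X s = Y s"
  shows "vector_derivative X (at x) = vector_derivative Y (at x)"
proof (rule vector_derivative_cong_eq)
  show "eventually (\<lambda>s. s \<in> UNIV \<longrightarrow> X s = Y s) (nhds x)"
    using assms by (auto simp: eventually_nhds)
qed simp_all

text \<open>In the planes of the first two and of the last two coordinates the curves
  \<open>(cos \<alpha>v, sin \<alpha>v)\<close> and \<open>(h(\<beta>v), k(\<beta>v))\<close> have constant squares \<open>1\<close> and \<open>-\<epsilon>\<close> in the
  induced forms \<open>dx\<^sup>2 + dy\<^sup>2\<close> and \<open>dz\<^sup>2 - dt\<^sup>2\<close>, are orthogonal to
  their derivatives, and are multiples of their second derivatives.  Hence all inner products
  depend on \<open>u\<close> only.\<close>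

lemma gauss_curvature_rotational:
  fixes f g h k :: "real \<Rightarrow> real" and \<alpha> \<beta> \<epsilon> u v :: real
  defines "X \<equiv> \<lambda>u v. vector [f u * cos (\<alpha> * v), f u * sin (\<alpha> * v), g u * h (\<beta> * v), g u * k (\<beta> * v)]"
  defines "E \<equiv> (deriv f u)\<^sup>2 - \<epsilon> * (deriv g u)\<^sup>2"
    and "G \<equiv> (\<alpha> * f u)\<^sup>2 + \<epsilon> * (\<beta> * g u)\<^sup>2"
  assumes J: "open J" "u \<in> J"
    and f: "\<And>s. s \<in> J \<Longrightarrow> f field_differentiable at s"
    and g: "\<And>s. s \<in> J \<Longrightarrow> g field_differentiable at s"
    and f': "deriv f field_differentiable at u"
    and g': "deriv g field_differentiable at u"
    and h: "\<And>x. (h has_real_derivative k x) (at x)"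
    and k: "\<And>x. (k has_real_derivative h x) (at x)"
    and hk: "\<And>x. (h x)\<^sup>2 - (k x)\<^sup>2 = - \<epsilon>"
    and \<epsilon>: "\<epsilon>\<^sup>2 = 1" and E: "E \<noteq> 0" and G: "G \<noteq> 0"
  shows "gauss_curvature X u v =
    (\<alpha>\<^sup>2 * \<beta>\<^sup>2 * (g u * deriv f u - f u * deriv g u)\<^sup>2 * (- \<epsilon> * (deriv f u)\<^sup>2 + (deriv g u)\<^sup>2)
     + (\<epsilon> * (\<alpha> * f u)\<^sup>2 + (\<beta> * g u)\<^sup>2) * (\<beta>\<^sup>2 * g u * deriv f u + \<alpha>\<^sup>2 * f u * deriv g u)
         * (deriv (deriv f) u * deriv g u - deriv f u * deriv (deriv g) u))
    / (((\<alpha> * f u)\<^sup>2 + \<epsilon> * (\<beta> * g u)\<^sup>2)\<^sup>2 * (- \<epsilon> * (deriv f u)\<^sup>2 + (deriv g u)\<^sup>2)\<^sup>2)"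
proof -
  note D_h = DERIV_chain2[of h, OF h] and D_k = DERIV_chain2[of k, OF k]
  have Df: "(f has_real_derivative deriv f s) (at s)" if "s \<in> J" for s
    using f[OF that] by (simp add: DERIV_deriv_iff_field_differentiable)
  have Dg: "(g has_real_derivative deriv g s) (at s)" if "s \<in> J" for s
    using g[OF that] by (simp add: DERIV_deriv_iff_field_differentiable)
  have Df': "(deriv f has_real_derivative deriv (deriv f) u) (at u)"
    using f' by (simp add: DERIV_deriv_iff_field_differentiable)
  have Dg': "(deriv g has_real_derivative deriv (deriv g) u) (at u)"
    using g' by (simp add: DERIV_deriv_iff_field_differentiable)

  have Xu: "partial_u X s w = vector [deriv f s * cos (\<alpha> * w), deriv f s * sin (\<alpha> * w),
      deriv g s * h (\<beta> * w), deriv g s * k (\<beta> * w)]" if "s \<in> J" for s w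
    unfolding partial_u_def X_def
    by (intro vector_derivative_vector_4 DERIV_cmult_right Df Dg that)
  have Xv: "partial_v X s w = vector [- \<alpha> * f s * sin (\<alpha> * w), \<alpha> * f s * cos (\<alpha> * w),
      \<beta> * g s * k (\<beta> * w), \<beta> * g s * h (\<beta> * w)]" for s w
    unfolding partial_v_def X_def
    by (intro vector_derivative_vector_4) (auto intro!: derivative_eq_intros D_h D_k)
  have Xuu: "partial_u (partial_u X) u v = vector [deriv (deriv f) u * cos (\<alpha> * v),
      deriv (deriv f) u * sin (\<alpha> * v), deriv (deriv g) u * h (\<beta> * v), deriv (deriv g) u * k (\<beta> * v)]"
    unfolding partial_u_def[of "partial_u X"]
    \<comment> \<open>The formula for \<open>X\<^sub>u\<close> holds only on \<open>J\<close>, which suffices because \<open>J\<close> is open.\<close>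
    by (subst vector_derivative_eq_on_open[OF J Xu])
       (auto intro!: vector_derivative_vector_4 DERIV_cmult_right Df' Dg')
  have Xuv: "partial_v (partial_u X) u v = vector [- \<alpha> * deriv f u * sin (\<alpha> * v),
      \<alpha> * deriv f u * cos (\<alpha> * v), \<beta> * deriv g u * k (\<beta> * v), \<beta> * deriv g u * h (\<beta> * v)]"
    unfolding partial_v_def Xu[OF J(2)]
    by (intro vector_derivative_vector_4) (auto intro!: derivative_eq_intros D_h D_k)
  have Xvv: "partial_v (partial_v X) u v = vector [- \<alpha>\<^sup>2 * f u * cos (\<alpha> * v),
      - \<alpha>\<^sup>2 * f u * sin (\<alpha> * v), \<beta>\<^sup>2 * g u * h (\<beta> * v), \<beta>\<^sup>2 * g u * k (\<beta> * v)]"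
    unfolding partial_v_def[of "partial_v X"] Xv
    by (intro vector_derivative_vector_4)
       (auto intro!: derivative_eq_intros D_h D_k simp: power2_eq_square)

  have cs: "(cos (\<alpha> * v))\<^sup>2 = 1 - (sin (\<alpha> * v))\<^sup>2"
    by (simp add: cos_squared_eq)
  have hs: "(h (\<beta> * v))\<^sup>2 = (k (\<beta> * v))\<^sup>2 - \<epsilon>"
    using hk[of "\<beta> * v"] by simp
  note inner = minkowski_def vector_4_nth
  have inner_products:
    "minkowski (partial_u X u v) (partial_u X u v) = E"
    "minkowski (partial_v X u v) (partial_v X u v) = G"
    "minkowski (partial_u X u v) (partial_v X u v) = 0"
    "minkowski (partial_u (partial_u X) u v) (partial_v (partial_v X) u v) =
       - \<alpha>\<^sup>2 * f u * deriv (deriv f) u - \<epsilon> * \<beta>\<^sup>2 * g u * deriv (deriv g) u"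
    "minkowski (partial_u (partial_u X) u v) (partial_u X u v) =
       deriv f u * deriv (deriv f) u - \<epsilon> * deriv g u * deriv (deriv g) u"
    "minkowski (partial_v (partial_v X) u v) (partial_u X u v) =
       - \<alpha>\<^sup>2 * f u * deriv f u - \<epsilon> * \<beta>\<^sup>2 * g u * deriv g u"
    "minkowski (partial_u (partial_u X) u v) (partial_v X u v) = 0"
    "minkowski (partial_v (partial_u X) u v) (partial_v (partial_u X) u v) =
       \<alpha>\<^sup>2 * (deriv f u)\<^sup>2 + \<epsilon> * \<beta>\<^sup>2 * (deriv g u)\<^sup>2"
    "minkowski (partial_v (partial_u X) u v) (partial_u X u v) = 0"
    "minkowski (partial_v (partial_u X) u v) (partial_v X u v) =
       \<alpha>\<^sup>2 * f u * deriv f u + \<epsilon> * \<beta>\<^sup>2 * g u * deriv g u"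
    unfolding Xu[OF J(2)] Xv Xuu Xuv Xvv inner E_def G_def
    by (algebra add: cs hs)+

  have rational_identity:
    "(- \<alpha>\<^sup>2 * a * a2 - \<epsilon> * \<beta>\<^sup>2 * b * b2
        - (a1 * a2 - \<epsilon> * b1 * b2) * (- \<alpha>\<^sup>2 * a * a1 - \<epsilon> * \<beta>\<^sup>2 * b * b1) / e
        - (\<alpha>\<^sup>2 * a1\<^sup>2 + \<epsilon> * \<beta>\<^sup>2 * b1\<^sup>2 - (\<alpha>\<^sup>2 * a * a1 + \<epsilon> * \<beta>\<^sup>2 * b * b1)\<^sup>2 / d)) / (e * d)
     = (\<alpha>\<^sup>2 * \<beta>\<^sup>2 * (b * a1 - a * b1)\<^sup>2 * (- \<epsilon> * a1\<^sup>2 + b1\<^sup>2)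
        + (\<epsilon> * (\<alpha> * a)\<^sup>2 + (\<beta> * b)\<^sup>2) * (\<beta>\<^sup>2 * b * a1 + \<alpha>\<^sup>2 * a * b1) * (a2 * b1 - a1 * b2))
       / (d\<^sup>2 * (- \<epsilon> * a1\<^sup>2 + b1\<^sup>2)\<^sup>2)"
    if e: "e = a1\<^sup>2 - \<epsilon> * b1\<^sup>2" "e \<noteq> 0" and d: "d = (\<alpha> * a)\<^sup>2 + \<epsilon> * (\<beta> * b)\<^sup>2" "d \<noteq> 0"
    for a b a1 b1 a2 b2 e d :: real
  proof -
    have denominator: "(- \<epsilon> * a1\<^sup>2 + b1\<^sup>2)\<^sup>2 = e\<^sup>2"
      using e(1) \<epsilon> by algebra
    \<comment> \<open>Both differences are Gram determinants of pairs of vectors in a plane with the form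
      \<open>x\<^sup>2 - \<epsilon> y\<^sup>2\<close> or \<open>x\<^sup>2 + \<epsilon> y\<^sup>2\<close>.  Such a determinant is the product of the two coordinate
      determinants times that of the form, which is why each of them factors.\<close>
    have uu_vv: "e * (- \<alpha>\<^sup>2 * a * a2 - \<epsilon> * \<beta>\<^sup>2 * b * b2)
        - (a1 * a2 - \<epsilon> * b1 * b2) * (- \<alpha>\<^sup>2 * a * a1 - \<epsilon> * \<beta>\<^sup>2 * b * b1)
      = \<epsilon> * (\<beta>\<^sup>2 * b * a1 + \<alpha>\<^sup>2 * a * b1) * (a2 * b1 - a1 * b2)"
      using e(1) \<epsilon> by algebra
    have uv_uv: "d * (\<alpha>\<^sup>2 * a1\<^sup>2 + \<epsilon> * \<beta>\<^sup>2 * b1\<^sup>2) - (\<alpha>\<^sup>2 * a * a1 + \<epsilon> * \<beta>\<^sup>2 * b * b1)\<^sup>2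
      = \<epsilon> * \<alpha>\<^sup>2 * \<beta>\<^sup>2 * (b * a1 - a * b1)\<^sup>2"
      using d(1) \<epsilon> by algebra
    have "(- \<alpha>\<^sup>2 * a * a2 - \<epsilon> * \<beta>\<^sup>2 * b * b2
        - (a1 * a2 - \<epsilon> * b1 * b2) * (- \<alpha>\<^sup>2 * a * a1 - \<epsilon> * \<beta>\<^sup>2 * b * b1) / e
        - (\<alpha>\<^sup>2 * a1\<^sup>2 + \<epsilon> * \<beta>\<^sup>2 * b1\<^sup>2 - (\<alpha>\<^sup>2 * a * a1 + \<epsilon> * \<beta>\<^sup>2 * b * b1)\<^sup>2 / d))
      = (e * (- \<alpha>\<^sup>2 * a * a2 - \<epsilon> * \<beta>\<^sup>2 * b * b2)
          - (a1 * a2 - \<epsilon> * b1 * b2) * (- \<alpha>\<^sup>2 * a * a1 - \<epsilon> * \<beta>\<^sup>2 * b * b1)) / e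
        - (d * (\<alpha>\<^sup>2 * a1\<^sup>2 + \<epsilon> * \<beta>\<^sup>2 * b1\<^sup>2) - (\<alpha>\<^sup>2 * a * a1 + \<epsilon> * \<beta>\<^sup>2 * b * b1)\<^sup>2) / d"
      using e(2) d(2) by (simp add: diff_divide_distrib)
    also have "\<dots> = (d * (\<epsilon> * (\<beta>\<^sup>2 * b * a1 + \<alpha>\<^sup>2 * a * b1) * (a2 * b1 - a1 * b2))
        - e * (\<epsilon> * \<alpha>\<^sup>2 * \<beta>\<^sup>2 * (b * a1 - a * b1)\<^sup>2)) / (e * d)"
      unfolding uu_vv uv_uv using e(2) d(2) by (simp add: diff_divide_distrib)
    also have "d * (\<epsilon> * (\<beta>\<^sup>2 * b * a1 + \<alpha>\<^sup>2 * a * b1) * (a2 * b1 - a1 * b2))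
        - e * (\<epsilon> * \<alpha>\<^sup>2 * \<beta>\<^sup>2 * (b * a1 - a * b1)\<^sup>2)
      = \<alpha>\<^sup>2 * \<beta>\<^sup>2 * (b * a1 - a * b1)\<^sup>2 * (- \<epsilon> * a1\<^sup>2 + b1\<^sup>2)
        + (\<epsilon> * (\<alpha> * a)\<^sup>2 + (\<beta> * b)\<^sup>2) * (\<beta>\<^sup>2 * b * a1 + \<alpha>\<^sup>2 * a * b1) * (a2 * b1 - a1 * b2)"
      using d(1) e(1) \<epsilon> by algebra
    finally show ?thesis
      unfolding denominator by (simp add: power2_eq_square mult_ac)
  qed

  have "gauss_curvature X u v =
    (- \<alpha>\<^sup>2 * f u * deriv (deriv f) u - \<epsilon> * \<beta>\<^sup>2 * g u * deriv (deriv g) u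
      - (deriv f u * deriv (deriv f) u - \<epsilon> * deriv g u * deriv (deriv g) u)
          * (- \<alpha>\<^sup>2 * f u * deriv f u - \<epsilon> * \<beta>\<^sup>2 * g u * deriv g u) / E
      - (\<alpha>\<^sup>2 * (deriv f u)\<^sup>2 + \<epsilon> * \<beta>\<^sup>2 * (deriv g u)\<^sup>2
          - (\<alpha>\<^sup>2 * f u * deriv f u + \<epsilon> * \<beta>\<^sup>2 * g u * deriv g u)\<^sup>2 / G)) / (E * G)"
    using gauss_curvature_orthogonal[of X u v] E G unfolding inner_products by simp
  also have "\<dots> = (\<alpha>\<^sup>2 * \<beta>\<^sup>2 * (g u * deriv f u - f u * deriv g u)\<^sup>2
        * (- \<epsilon> * (deriv f u)\<^sup>2 + (deriv g u)\<^sup>2)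
      + (\<epsilon> * (\<alpha> * f u)\<^sup>2 + (\<beta> * g u)\<^sup>2) * (\<beta>\<^sup>2 * g u * deriv f u + \<alpha>\<^sup>2 * f u * deriv g u)
          * (deriv (deriv f) u * deriv g u - deriv f u * deriv (deriv g) u))
      / (G\<^sup>2 * (- \<epsilon> * (deriv f u)\<^sup>2 + (deriv g u)\<^sup>2)\<^sup>2)"
    using E G by (intro rational_identity) (simp_all only: E_def G_def not_False_eq_True)
  finally show ?thesis
    unfolding G_def .
qed

section \<open>The weighted curvature\<close>

theorem proposition2:
  fixes i :: nat and \<epsilon> \<alpha> \<beta> \<delta> l1 l2 l3 l4 u v :: real
    and J :: "real set" and f g f' g' f'' g'' :: "real \<Rightarrow> real" and \<phi> :: "real ^ 4 \<Rightarrow> real"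
  assumes "i \<in> {1, 2}"
    and "\<epsilon> = (-1) ^ i"
    and "timelike_rotational_data i J \<alpha> \<beta> f g"
    and "\<not> (l1 = 0 \<and> l2 = 0 \<and> l3 = 0 \<and> l4 = 0)"
    and "\<delta> = l1 + l2 + l3 - l4"
    and "\<phi> = (\<lambda>p. l1 * (p $ 1)\<^sup>2 + l2 * (p $ 2)\<^sup>2 + l3 * (p $ 3)\<^sup>2 + l4 * (p $ 4)\<^sup>2)"
    and "f' = deriv f" and "g' = deriv g" and "f'' = deriv f'" and "g'' = deriv g'"
    and "u \<in> J" and "v \<in> {0..<2 * pi}"
  shows "weighted_gauss_curvature \<phi> (rotational_surface i \<alpha> \<beta> f g) u v =
    (- 2 * \<delta> * ((\<alpha> * f u)\<^sup>2 + \<epsilon> * (\<beta> * g u)\<^sup>2)\<^sup>2 * (- \<epsilon> * (f' u)\<^sup>2 + (g' u)\<^sup>2)\<^sup>2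
     + \<alpha>\<^sup>2 * \<beta>\<^sup>2 * (g u * f' u - f u * g' u)\<^sup>2 * (- \<epsilon> * (f' u)\<^sup>2 + (g' u)\<^sup>2)
     + (\<epsilon> * (\<alpha> * f u)\<^sup>2 + (\<beta> * g u)\<^sup>2) * (\<beta>\<^sup>2 * g u * f' u + \<alpha>\<^sup>2 * f u * g' u)
         * (f'' u * g' u - f' u * g'' u))
    / (((\<alpha> * f u)\<^sup>2 + \<epsilon> * (\<beta> * g u)\<^sup>2)\<^sup>2 * (- \<epsilon> * (f' u)\<^sup>2 + (g' u)\<^sup>2)\<^sup>2)"
proof -
  have open_J: "open J"
    and f: "\<And>s. s \<in> J \<Longrightarrow> f field_differentiable at s"
    and g: "\<And>s. s \<in> J \<Longrightarrow> g field_differentiable at s"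
    and f': "deriv f field_differentiable at u"
    and g': "deriv g field_differentiable at u"
  proof -
    have smooth: "\<And>n s. s \<in> J \<Longrightarrow> (deriv ^^ n) f field_differentiable at s"
      "\<And>n s. s \<in> J \<Longrightarrow> (deriv ^^ n) g field_differentiable at s"
      using assms(3) by (auto simp: timelike_rotational_data_def smooth_on_open_def)
    show "open J"
      using assms(3) by (simp add: timelike_rotational_data_def)
    show "f field_differentiable at s" "g field_differentiable at s" if "s \<in> J" for s
      using smooth[OF that, of 0] by simp_all
    show "deriv f field_differentiable at u" "deriv g field_differentiable at u"
      using smooth[OF assms(11), of 1] by simp_all
  qed
  have timelike: "if i = 1
      then \<alpha>\<^sup>2 * (f u)\<^sup>2 - \<beta>\<^sup>2 * (g u)\<^sup>2 < 0 \<and> (deriv f u)\<^sup>2 + (deriv g u)\<^sup>2 > 0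
      else (deriv f u)\<^sup>2 - (deriv g u)\<^sup>2 < 0 \<and> \<alpha>\<^sup>2 * (f u)\<^sup>2 + \<beta>\<^sup>2 * (g u)\<^sup>2 > 0"
    using assms(3,11) unfolding timelike_rotational_data_def by blast
  have E: "(deriv f u)\<^sup>2 - \<epsilon> * (deriv g u)\<^sup>2 \<noteq> 0" and G: "(\<alpha> * f u)\<^sup>2 + \<epsilon> * (\<beta> * g u)\<^sup>2 \<noteq> 0"
    using timelike assms(1,2) by (auto simp: power_mult_distrib)
  have \<epsilon>: "\<epsilon>\<^sup>2 = 1"
    using assms(1,2) by auto

  have curvature: "gauss_curvature (rotational_surface i \<alpha> \<beta> f g) u v =
    (\<alpha>\<^sup>2 * \<beta>\<^sup>2 * (g u * f' u - f u * g' u)\<^sup>2 * (- \<epsilon> * (f' u)\<^sup>2 + (g' u)\<^sup>2)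
     + (\<epsilon> * (\<alpha> * f u)\<^sup>2 + (\<beta> * g u)\<^sup>2) * (\<beta>\<^sup>2 * g u * f' u + \<alpha>\<^sup>2 * f u * g' u)
         * (f'' u * g' u - f' u * g'' u))
    / (((\<alpha> * f u)\<^sup>2 + \<epsilon> * (\<beta> * g u)\<^sup>2)\<^sup>2 * (- \<epsilon> * (f' u)\<^sup>2 + (g' u)\<^sup>2)\<^sup>2)"
  proof (cases "i = 1")
    case True
    have surface: "rotational_surface i \<alpha> \<beta> f g = (\<lambda>u v. vector
        [f u * cos (\<alpha> * v), f u * sin (\<alpha> * v), g u * cosh (\<beta> * v), g u * sinh (\<beta> * v)])"
      using True by (intro ext) (simp add: rotational_surface_def)
    have square: "(cosh x)\<^sup>2 - (sinh x)\<^sup>2 = - \<epsilon>" for x :: real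
      using True assms(2) by (simp add: hyperbolic_pythagoras)
    show ?thesis
      unfolding surface assms(7-10)
      by (rule gauss_curvature_rotational[OF open_J assms(11) f g f' g' _ _ square \<epsilon> E G])
         (auto intro!: derivative_eq_intros)
  next
    case False
    have surface: "rotational_surface i \<alpha> \<beta> f g = (\<lambda>u v. vector
        [f u * cos (\<alpha> * v), f u * sin (\<alpha> * v), g u * sinh (\<beta> * v), g u * cosh (\<beta> * v)])"
      using False by (intro ext) (simp add: rotational_surface_def)
    have square: "(sinh x)\<^sup>2 - (cosh x)\<^sup>2 = - \<epsilon>" for x :: real
      using False assms(1,2) by (simp add: cosh_square_eq)
    show ?thesis
      unfolding surface assms(7-10)
      by (rule gauss_curvature_rotational[OF open_J assms(11) f g f' g' _ _ square \<epsilon> E G])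
         (auto intro!: derivative_eq_intros)
  qed
  have laplacian: "minkowski_laplacian \<phi> p = 2 * \<delta>" for p
    unfolding assms(5,6) by (rule minkowski_laplacian_diagonal_quadratic)

  have absorb: "(a + b) / (d * e) - 2 * \<delta> = (- 2 * \<delta> * d * e + a + b) / (d * e)"
    if "d \<noteq> 0" "e \<noteq> 0" for a b d e :: real
    using that by (simp add: field_simps)
  have "(- \<epsilon> * (f' u)\<^sup>2 + (g' u)\<^sup>2)\<^sup>2 = ((deriv f u)\<^sup>2 - \<epsilon> * (deriv g u)\<^sup>2)\<^sup>2"
    unfolding assms(7,8) using \<epsilon> by algebra
  then have "(- \<epsilon> * (f' u)\<^sup>2 + (g' u)\<^sup>2)\<^sup>2 \<noteq> 0"
    using E by simp
  then show ?thesis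
    unfolding weighted_gauss_curvature_def curvature laplacian
    using G by (intro absorb) simp_all
qed

end
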